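(* For $0<\alpha\le 1$ and $i\in\mathbb{N}_0$, the moment $$\tau_i^{\alpha}=\int_{-1}^{1}T_i(M_\alpha(x))\,\mathrm{d}x$$ equals the $i$-th coefficient $\mathcal{F}_{\cos}(g_\alpha)(i)$ of the continuous cosine transform of the function $$g_\alpha(t)=\frac{\sin(t)}{\sqrt{\frac{1}{\sin^2(\alpha\pi/2)}-\cos^2(t)}}\,\frac{1}{\alpha},\qquad t\in[0,\pi].$$ For $\alpha=0$, the moments $\tau_i^0=\int_{-1}^{1}T_i(M_0(x))\,\mathrm{d}x$, $i\in\mathbb{N}_0$, are given by $$\tau_i^0=\begin{cases}0 & \text{if } i \text{ is odd},\\ \frac{2}{1-i^2} & \text{if } i \text{ is even}.\end{cases}$$
   Context: $T_i(x)=\cos(i\arccos x)$, $x\in[-1,1]$, is the $i$-th Chebyshev polynomial of the first kind. The Kosloff Tal-Ezer map $M_\alpha:[-1,1]\to[-1,1]$ is $M_\alpha(x)=\frac{\sin(\alpha\pi x/2)}{\sin(\alpha\pi/2)}$ for $0<\alpha\le1$ and $M_0(x)=x$. The $i$-th coefficient of the continuous cosine transform of a function $g$ on $[0,\pi]$ is $\mathcal{F}_{\cos}(g)(i)=\frac{2}{\pi}\int_0^\pi g(t)\cos(it)\,\mathrm{d}t$, so that the cosine series of $g$ reads $\frac{\mathcal{F}_{\cos}(g)(0)}{2}+\sum_{n\ge1}\mathcal{F}_{\cos}(g)(n)\cos(nt)$. For $\alpha=1$ the expression for $g_\alpha$ is of the form $0/0$ at $t=0,\pi$; it is understood as extended by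 continuity, $g_1\equiv 1$. *)

theory Defs
  imports "HOL-Analysis.Analysis"
begin

definition cheb_T :: "nat \<Rightarrow> real \<Rightarrow> real" where
  "cheb_T i x = cos (real i * arccos x)"

text \<open>The Kosloff Tal-Ezer map.\<close>

definition kte_map :: "real \<Rightarrow> real \<Rightarrow> real" where
  "kte_map \<alpha> x =
     (if \<alpha> = 0 then x else sin (\<alpha> * pi * x / 2) / sin (\<alpha> * pi / 2))"

definition kte_moment :: "real \<Rightarrow> nat \<Rightarrow> real" where
  "kte_moment \<alpha> i = integral {-1..1} (\<lambda>x. cheb_T i (kte_map \<alpha> x))"

definition cos_transform :: "(real \<Rightarrow> real) \<Rightarrow> nat \<Rightarrow> real" where
  "cos_transform g i = 2 / pi * integral {0..pi} (\<lambda>t. g t * cos (real i * t))"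

text \<open>Only the values on \<open>{0..pi}\<close> matter. For \<open>\<alpha> = 1\<close> the quotient is \<open>0 / 0\<close> at the two
  endpoints; there the function takes its continuous extension, see \<open>kte_g_1\<close> below.\<close>

definition kte_g :: "real \<Rightarrow> real \<Rightarrow> real" where
  "kte_g \<alpha> t =
     (if \<alpha> = 1 \<and> t \<in> {0, pi} then 1
      else sin t / sqrt (1 / (sin (\<alpha> * pi / 2))\<^sup>2 - (cos t)\<^sup>2) * (1 / \<alpha>))"

lemma kte_g_1:
  assumes "t \<in> {0..pi}"
  shows "kte_g 1 t = 1"
proof (cases "t \<in> {0, pi}")
  case False
  with assms have "sin t > 0"
    by (intro sin_gt_zero) auto
  moreover have "1 - (cos t)\<^sup>2 = (sin t)\<^sup>2"
    by (simp add: sin_squared_eq)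
  ultimately show ?thesis
    using False by (simp add: kte_g_def)
qed (simp add: kte_g_def)

text \<open>The integrands above are continuous, so the integrals are the intended ones and not the
  default value \<open>0\<close> of non-integrable functions.\<close>

lemma sin_half_pos:
  fixes \<alpha> :: real
  assumes "0 < \<alpha>" "\<alpha> \<le> 1"
  shows "sin (\<alpha> * pi / 2) > 0"
proof (rule sin_gt_zero)
  have "\<alpha> * pi \<le> 1 * pi"
    using assms by (intro mult_right_mono) auto
  then show "\<alpha> * pi / 2 < pi"
    using pi_gt_zero by linarith
qed (use assms in simp)

lemma kte_map_in_range:
  assumes "0 \<le> \<alpha>" "\<alpha> \<le> 1" "x \<in> {-1..1}"
  shows "kte_map \<alpha> x \<in> {-1..1}"
proof (cases "\<alpha> = 0")
  case False
  then have pos: "sin (\<alpha> * pi / 2) > 0"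
    using assms sin_half_pos by simp
  have a: "0 \<le> \<alpha> * pi / 2" "\<alpha> * pi / 2 \<le> pi / 2"
    using assms by (auto simp: mult_left_le_one_le)
  have b: "(\<alpha> * pi / 2) * x \<le> (\<alpha> * pi / 2) * 1" "(\<alpha> * pi / 2) * (-1) \<le> (\<alpha> * pi / 2) * x"
    using assms(3) a by (intro mult_left_mono; simp)+
  have "sin ((\<alpha> * pi / 2) * x) \<le> sin (\<alpha> * pi / 2)"
    using a b by (intro sin_monotone_2pi_le; linarith)
  moreover have "sin (- (\<alpha> * pi / 2)) \<le> sin ((\<alpha> * pi / 2) * x)"
    using a b by (intro sin_monotone_2pi_le; linarith)
  ultimately show ?thesis
    using False pos by (auto simp: kte_map_def field_simps)
qed (use assms in \<open>simp add: kte_map_def\<close>)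

lemma continuous_on_moment_integrand:
  assumes "0 \<le> \<alpha>" "\<alpha> \<le> 1"
  shows "continuous_on {-1..1} (\<lambda>x. cheb_T i (kte_map \<alpha> x))"
proof -
  have "continuous_on {-1..1} (kte_map \<alpha>)"
  proof (cases "\<alpha> = 0")
    case False
    then have "sin (\<alpha> * pi / 2) \<noteq> 0"
      using assms sin_half_pos[of \<alpha>] by simp
    with False show ?thesis
      unfolding kte_map_def by (auto intro!: continuous_intros)
  qed (auto simp: kte_map_def intro!: continuous_intros)
  then show ?thesis
    unfolding cheb_T_def using kte_map_in_range[OF assms]
    by (auto intro!: continuous_intros)
qed

lemma continuous_on_kte_g:
  assumes "0 < \<alpha>" "\<alpha> \<le> 1"
  shows "continuous_on {0..pi} (kte_g \<alpha>)"
proof (cases "\<alpha> = 1")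
  case True
  have "continuous_on {0..pi} (kte_g 1) \<longleftrightarrow> continuous_on {0..pi} (\<lambda>_. 1 :: real)"
    by (intro continuous_on_cong refl kte_g_1)
  with True show ?thesis
    by simp
next
  case False
  let ?s = "sin (\<alpha> * pi / 2)"
  have pos: "?s > 0"
    using assms sin_half_pos by simp
  have "?s < sin (pi / 2)"
    using assms False by (intro sin_monotone_2pi) (auto intro: order_trans[of _ 0])
  then have "?s\<^sup>2 < 1"
    using pos by (simp add: power_less_one_iff abs_square_less_1)
  then have "1 < 1 / ?s\<^sup>2"
    using pos by simp
  moreover have "(cos t)\<^sup>2 \<le> 1" for t :: real
    by (simp add: abs_square_le_1)
  ultimately have "sqrt (1 / ?s\<^sup>2 - (cos t)\<^sup>2) \<noteq> 0" for t
    by (smt (verit) real_sqrt_eq_zero_cancel_iff)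
  with pos False assms show ?thesis
    unfolding kte_g_def by (auto intro!: continuous_intros simp del: real_sqrt_eq_zero_cancel_iff)
qed

end

theory Submission
  imports Defs
begin

text \<open>
  The moment is computed by the substitution that turns the map into the cosine. If
  \<open>\<phi> : {0..pi} \<rightarrow> {-1..1}\<close> runs from \<open>1\<close> down to \<open>-1\<close> and satisfies \<open>M\<^sub>\<alpha> (\<phi> t) = cos t\<close>, then
  \<open>T\<^sub>i (M\<^sub>\<alpha> (\<phi> t)) = cos (i t)\<close>, so the moment is the integral of \<open>- \<phi>' t * cos (i t)\<close> over
  \<open>{0..pi}\<close> (lemma \<open>has_integral_cosine_substitution\<close>).

  For \<open>\<alpha> > 0\<close>, solving \<open>M\<^sub>\<alpha> (\<phi> t) = cos t\<close> gives
  \<open>\<phi> t = 2 / (\<alpha> pi) * arcsin (sin (\<alpha> pi / 2) * cos t)\<close>, and differentiating it gives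
  \<open>- \<phi>' = 2 / pi * g\<^sub>\<alpha>\<close> inside the interval (lemma \<open>kte_inverse_has_derivative\<close>); this is the cosine transform. For
  \<open>\<alpha> = 0\<close>, \<open>\<phi> = cos\<close> and the integral of \<open>sin t * cos (i t)\<close> is elementary.
\<close>

lemma cheb_T_cos:
  assumes "t \<in> {0..pi}"
  shows "cheb_T i (cos t) = cos (real i * t)"
  using assms by (simp add: cheb_T_def arccos_cos)

text \<open>The derivative is only required in the open interval: for \<open>\<alpha> = 1\<close> the inverse substitution
  below involves \<open>arcsin\<close> at \<open>1\<close> and \<open>-1\<close>, where \<open>arcsin\<close> is not differentiable.\<close>

lemma has_integral_cosine_substitution:
  assumes "0 \<le> \<alpha>" "\<alpha> \<le> 1"
    and cont: "continuous_on {0..pi} \<phi>"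
    and range: "\<phi> ` {0..pi} \<subseteq> {-1..1}"
    and ends: "\<phi> 0 = 1" "\<phi> pi = -1"
    and inverse: "\<And>t. t \<in> {0..pi} \<Longrightarrow> kte_map \<alpha> (\<phi> t) = cos t"
    and deriv: "\<And>t. t \<in> {0<..<pi} \<Longrightarrow> (\<phi> has_real_derivative - w t) (at t)"
  shows "((\<lambda>t. w t * cos (real i * t)) has_integral kte_moment \<alpha> i) {0..pi}"
proof -
  let ?f = "\<lambda>x. cheb_T i (kte_map \<alpha> x)"
  have "((\<lambda>t. (- w t) *\<^sub>R ?f (\<phi> t)) has_integral
      (integral {\<phi> 0..\<phi> pi} ?f - integral {\<phi> pi..\<phi> 0} ?f)) {0..pi}"
  proof (rule has_integral_substitution_general[of "{0, pi}"])
    show "continuous_on {-1..1} ?f"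
      using assms(1,2) by (rule continuous_on_moment_integrand)
    show "(\<phi> has_field_derivative - w t) (at t within {0..pi})" if "t \<in> {0..pi} - {0, pi}" for t
      using that by (intro has_field_derivative_at_within[OF deriv]) auto
  qed (use cont range in auto)
  then have "((\<lambda>t. - (w t * ?f (\<phi> t))) has_integral - kte_moment \<alpha> i) {0..pi}"
    by (simp add: ends kte_moment_def)
  then have "((\<lambda>t. w t * ?f (\<phi> t)) has_integral kte_moment \<alpha> i) {0..pi}"
    by (simp add: has_integral_neg_iff)
  moreover have "w t * ?f (\<phi> t) = w t * cos (real i * t)" if "t \<in> {0..pi}" for t
    using that by (simp add: inverse cheb_T_cos)
  ultimately show ?thesis
    by (rule has_integral_eq[rotated])
qed

text \<open>With \<open>s = sin (\<alpha> pi / 2)\<close> the chain rule gives the derivative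
  \<open>- 2 / (\<alpha> pi) * s sin t / sqrt (1 - s\<^sup>2 cos\<^sup>2 t)\<close>; cancelling \<open>s\<close> in the fraction produces the
  term \<open>1 / s\<^sup>2\<close> in \<open>g\<^sub>\<alpha>\<close>.\<close>

lemma kte_inverse_has_derivative:
  assumes "0 < \<alpha>" "\<alpha> \<le> 1" and t: "t \<in> {0<..<pi}"
  shows "((\<lambda>t. 2 / (\<alpha> * pi) * arcsin (sin (\<alpha> * pi / 2) * cos t))
    has_real_derivative - (2 / pi * kte_g \<alpha> t)) (at t)"
proof -
  define s where "s = sin (\<alpha> * pi / 2)"
  have s: "0 < s" "s \<le> 1"
    using sin_half_pos[OF assms(1,2)] by (auto simp: s_def)
  have "\<bar>cos t\<bar> < 1"
    using cos_monotone_0_pi[of 0 t] cos_monotone_0_pi[of t pi] t by auto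
  moreover have "\<bar>s * cos t\<bar> \<le> \<bar>cos t\<bar>"
    using s by (simp add: abs_mult mult_left_le_one_le)
  ultimately have "\<bar>s * cos t\<bar> < 1"
    by linarith
  then have bounds: "-1 < s * cos t" "s * cos t < 1"
    by auto
  have "1 / s\<^sup>2 - (cos t)\<^sup>2 = (1 - (s * cos t)\<^sup>2) / s\<^sup>2"
    using s by (simp add: field_simps)
  then have root: "sqrt (1 / s\<^sup>2 - (cos t)\<^sup>2) = sqrt (1 - (s * cos t)\<^sup>2) / s"
    using s by (simp add: real_sqrt_divide)
  have "((\<lambda>t. 2 / (\<alpha> * pi) * arcsin (s * cos t)) has_real_derivative
      2 / (\<alpha> * pi) * (inverse (sqrt (1 - (s * cos t)\<^sup>2)) * (s * - sin t))) (at t)"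
    using bounds
    by (intro DERIV_cmult DERIV_chain2[of arcsin] DERIV_arcsin DERIV_cos)
  also have "2 / (\<alpha> * pi) * (inverse (sqrt (1 - (s * cos t)\<^sup>2)) * (s * - sin t))
      = - (2 / pi * kte_g \<alpha> t)"
    using t s by (simp add: kte_g_def root flip: s_def) (simp add: field_simps)
  finally show ?thesis
    by (simp only: s_def)
qed

lemma kte_moment_eq_cos_transform:
  assumes "0 < \<alpha>" "\<alpha> \<le> 1"
  shows "kte_moment \<alpha> i = cos_transform (kte_g \<alpha>) i"
proof -
  define s where "s = sin (\<alpha> * pi / 2)"
  define \<phi> where "\<phi> t = 2 / (\<alpha> * pi) * arcsin (s * cos t)" for t
  have s: "0 < s" "s \<le> 1"
    using sin_half_pos[OF assms] by (auto simp: s_def)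
  have half: "0 \<le> \<alpha> * pi / 2" "\<alpha> * pi / 2 \<le> pi / 2"
    using assms by auto
  have arcsin_s: "arcsin s = \<alpha> * pi / 2"
    unfolding s_def using half pi_ge_zero by (intro arcsin_sin; linarith)
  have scos: "- s \<le> s * cos t" "s * cos t \<le> s" for t
    using s mult_left_mono[of "-1" "cos t" s] mult_left_mono[of "cos t" 1 s] by auto
  have bounds: "-1 \<le> s * cos t" "s * cos t \<le> 1" for t
    using scos[of t] s by linarith+
  have "- arcsin s \<le> arcsin (s * cos t)" "arcsin (s * cos t) \<le> arcsin s" for t
    using scos[of t] bounds[of t] s
    by (auto intro!: arcsin_le_arcsin simp flip: arcsin_minus)
  then have "\<bar>arcsin (s * cos t)\<bar> \<le> \<alpha> * pi / 2" for t
    unfolding arcsin_s[symmetric] by (simp add: abs_le_iff minus_le_iff)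
  then have "\<bar>\<phi> t\<bar> \<le> 1" for t
    using assms by (simp add: \<phi>_def abs_mult field_simps)
  then have range: "\<phi> ` {0..pi} \<subseteq> {-1..1}"
    by (auto simp: abs_le_iff minus_le_iff)
  have "((\<lambda>t. 2 / pi * kte_g \<alpha> t * cos (real i * t)) has_integral kte_moment \<alpha> i) {0..pi}"
  proof (rule has_integral_cosine_substitution[where \<phi> = \<phi>])
    show "continuous_on {0..pi} \<phi>"
      unfolding \<phi>_def using bounds by (intro continuous_intros) auto
    show "\<phi> 0 = 1" "\<phi> pi = -1"
      using assms s by (simp_all add: \<phi>_def arcsin_minus arcsin_s)
    show "kte_map \<alpha> (\<phi> t) = cos t" for t
      using assms s bounds[of t] by (simp add: kte_map_def \<phi>_def flip: s_def)
    show "(\<phi> has_real_derivative - (2 / pi * kte_g \<alpha> t)) (at t)" if "t \<in> {0<..<pi}" for t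
      using kte_inverse_has_derivative[OF assms that] by (simp add: \<phi>_def[abs_def] s_def)
  qed (use assms range in auto)
  then have "kte_moment \<alpha> i = integral {0..pi} (\<lambda>t. 2 / pi * kte_g \<alpha> t * cos (real i * t))"
    by (rule integral_unique[symmetric])
  then show ?thesis
    by (simp only: cos_transform_def mult.assoc integral_mult_right)
qed

lemma has_integral_sin_times_cos_multiple:
  "((\<lambda>t. sin t * cos (real i * t)) has_integral (if odd i then 0 else 2 / (1 - (real i)\<^sup>2)))
    {0..pi}"
proof (cases "i = 1")
  case True
  have "((\<lambda>t. sin t * cos t) has_integral (sin pi)\<^sup>2 / 2 - (sin 0)\<^sup>2 / 2) {0..pi}"
    by (intro fundamental_theorem_of_calculus)
      (auto intro!: derivative_eq_intros simp flip: has_real_derivative_iff_has_vector_derivative)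
  with True show ?thesis
    by simp
next
  case False
  define d where "d = (real i)\<^sup>2 - 1"
  have d: "d \<noteq> 0"
    using False by (simp add: d_def power2_eq_1_iff)
  \<comment> \<open>Integrating by parts twice returns \<open>i\<^sup>2\<close> times the original integral, whence this
    antiderivative, which breaks down exactly at \<open>i = 1\<close>.\<close>
  define F where "F t = (cos t * cos (real i * t) + real i * sin t * sin (real i * t)) / d" for t
  have "((\<lambda>t. sin t * cos (real i * t)) has_integral F pi - F 0) {0..pi}"
  proof (intro fundamental_theorem_of_calculus)
    have "(F has_real_derivative sin t * cos (real i * t)) (at t within {0..pi})" for t
    proof -
      have "(F has_real_derivative (d * (sin t * cos (real i * t))) / d) (at t within {0..pi})"
        unfolding F_def[abs_def]
        by (rule DERIV_cdivide)
          (auto intro!: derivative_eq_intros simp: d_def algebra_simps power2_eq_square)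
      with d show ?thesis
        by simp
    qed
    then show "(F has_vector_derivative sin t * cos (real i * t)) (at t within {0..pi})" for t
      by (simp add: has_real_derivative_iff_has_vector_derivative)
  qed simp
  moreover have "1 - (real i)\<^sup>2 = - d"
    by (simp add: d_def)
  then have "F pi - F 0 = (if odd i then 0 else 2 / (1 - (real i)\<^sup>2))"
    by (simp add: F_def)
  ultimately show ?thesis
    by simp
qed

lemma kte_moment_zero:
  "kte_moment 0 i = (if odd i then 0 else 2 / (1 - (real i)\<^sup>2))"
proof -
  have "((\<lambda>t. sin t * cos (real i * t)) has_integral kte_moment 0 i) {0..pi}"
  proof (rule has_integral_cosine_substitution[where \<phi> = cos])
    show "(cos has_real_derivative - sin t) (at t)" for t :: real
      by (rule DERIV_cos)
  qed (auto simp: kte_map_def intro!: continuous_intros)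
  then show ?thesis
    using has_integral_sin_times_cos_multiple has_integral_unique by blast
qed

theorem theorem1:
  shows "(\<forall>(\<alpha>::real) (i::nat). 0 < \<alpha> \<and> \<alpha> \<le> 1 \<longrightarrow>
            kte_moment \<alpha> i = cos_transform (kte_g \<alpha>) i) \<and>
         (\<forall>i::nat. kte_moment 0 i = (if odd i then 0 else 2 / (1 - (real i)\<^sup>2)))"
  using kte_moment_eq_cos_transform kte_moment_zero by blast

end
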